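(* Let $\mathcal{E}$ be a category with pullbacks. Then $\mathbf{Poly}_{\mathcal{E}}$, with polynomials in $\mathcal{E}$ as objects, morphisms of polynomials as morphisms, and the identities and composition specified in the context, is a category (i.e. composition is unital and associative).
   Context: For $f\colon B\to A$ in a category $\mathcal{E}$ with pullbacks, $\Delta_f\colon\mathcal{E}/A\to\mathcal{E}/B$ denotes pullback along $f$. The morphism $f$ is exponentiable if $\Delta_f$ has a right adjoint, denoted $\Pi_f\colon\mathcal{E}/B\to\mathcal{E}/A$. A polynomial $p$ in $\mathcal{E}$ is an exponentiable morphism $p\colon P_*\to P$ of $\mathcal{E}$ (the codomain of $p$ is written $P$, the domain $P_*$). A morphism of polynomials $\phi\colon p\to q$ consists of a morphism $\phi_1\colon P\to Q$ and a morphism $\phi^\sharp\colon P\times_Q Q_*\to P_*$ (pullback of $q$ along $\phi_1$) such that $p\circ\phi^\sharp$ is the projection $P\times_Q Q_*\to P$; such data are taken up to isomorphism of the choice of the pullback $P\times_Q Q_*$. The identity on $p$ is $(\mathrm{id}_P,\mathrm{id}_{P_*})$, using the pullback $P\times_P P_*=P_*$. The composite of $\phi\colon p\to q$ and $\psi\colon q\to r$ has $(\psi\circ\phi)_1=\psi_1\circ\phi_1$, and $(\psi\circ\phi)^\sharp$ is the composite $$P\times_R R_*\cong P\times_Q(Q\times_R R_* )\xrightarrow{P\times_Q\psi^\sharp}P\times_Q Q_*\xrightarrow{\phi^\sharp}P_*.$$ *)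

theory Defs
  imports Main
begin

section \<open>Categories, functors and adjunctions\<close>

record ('o, 'm) cat =
  Obj :: "'o set"
  Arr :: "'m set"
  Dom :: "'m \<Rightarrow> 'o"
  Cod :: "'m \<Rightarrow> 'o"
  Id :: "'o \<Rightarrow> 'm"
  Comp :: "'m \<Rightarrow> 'm \<Rightarrow> 'm"  (infixr "\<cdot>\<index>" 70)

definition Hom :: "('o, 'm) cat \<Rightarrow> 'o \<Rightarrow> 'o \<Rightarrow> 'm set" where
  "Hom C x y = {f \<in> Arr C. Dom C f = x \<and> Cod C f = y}"

text \<open>\<open>g \<cdot>\<^bsub>C\<^esub> f\<close> is \<open>f\<close> followed by \<open>g\<close>; its value is irrelevant when \<open>f\<close> and \<open>g\<close> are
  not composable arrows.\<close>

locale category =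
  fixes C :: "('o, 'm) cat" (structure)
  assumes Dom_Obj: "f \<in> Arr C \<Longrightarrow> Dom C f \<in> Obj C"
    and Cod_Obj: "f \<in> Arr C \<Longrightarrow> Cod C f \<in> Obj C"
    and Id_Hom: "x \<in> Obj C \<Longrightarrow> Id C x \<in> Hom C x x"
    and Comp_Hom: "f \<in> Hom C x y \<Longrightarrow> g \<in> Hom C y z \<Longrightarrow> g \<cdot> f \<in> Hom C x z"
    and Comp_Id: "f \<in> Hom C x y \<Longrightarrow> f \<cdot> Id C x = f"
    and Id_Comp: "f \<in> Hom C x y \<Longrightarrow> Id C y \<cdot> f = f"
    and Comp_assoc: "f \<in> Hom C w x \<Longrightarrow> g \<in> Hom C x y \<Longrightarrow> h \<in> Hom C y z \<Longrightarrow>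
      h \<cdot> (g \<cdot> f) = (h \<cdot> g) \<cdot> f"

definition is_iso :: "('o, 'm) cat \<Rightarrow> 'm \<Rightarrow> bool" where
  "is_iso C f \<longleftrightarrow> f \<in> Arr C \<and>
     (\<exists>g \<in> Hom C (Cod C f) (Dom C f).
        g \<cdot>\<^bsub>C\<^esub> f = Id C (Dom C f) \<and> f \<cdot>\<^bsub>C\<^esub> g = Id C (Cod C f))"

record ('o1, 'm1, 'o2, 'm2) functor_data =
  OMap :: "'o1 \<Rightarrow> 'o2"
  AMap :: "'m1 \<Rightarrow> 'm2"

definition is_functor ::
  "('o1, 'm1) cat \<Rightarrow> ('o2, 'm2) cat \<Rightarrow> ('o1, 'm1, 'o2, 'm2) functor_data \<Rightarrow> bool" where
  "is_functor C D F \<longleftrightarrow>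
     (\<forall>x \<in> Obj C. OMap F x \<in> Obj D) \<and>
     (\<forall>x \<in> Obj C. \<forall>y \<in> Obj C. \<forall>f \<in> Hom C x y. AMap F f \<in> Hom D (OMap F x) (OMap F y)) \<and>
     (\<forall>x \<in> Obj C. AMap F (Id C x) = Id D (OMap F x)) \<and>
     (\<forall>f \<in> Arr C. \<forall>g \<in> Arr C. Cod C f = Dom C g \<longrightarrow>
        AMap F (g \<cdot>\<^bsub>C\<^esub> f) = AMap F g \<cdot>\<^bsub>D\<^esub> AMap F f)"

text \<open>\<open>is_right_adjoint C D F G\<close>: the functor \<open>G : D \<rightarrow> C\<close> is right adjoint to \<open>F : C \<rightarrow> D\<close>,
  expressed by a bijection \<open>D(F x, y) \<cong> C(x, G y)\<close> natural in \<open>x\<close> and \<open>y\<close>.\<close>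

definition is_right_adjoint ::
  "('o1, 'm1) cat \<Rightarrow> ('o2, 'm2) cat \<Rightarrow> ('o1, 'm1, 'o2, 'm2) functor_data \<Rightarrow>
   ('o2, 'm2, 'o1, 'm1) functor_data \<Rightarrow> bool" where
  "is_right_adjoint C D F G \<longleftrightarrow>
     is_functor C D F \<and> is_functor D C G \<and>
     (\<exists>\<Phi> :: 'o1 \<Rightarrow> 'o2 \<Rightarrow> 'm2 \<Rightarrow> 'm1.
        (\<forall>x \<in> Obj C. \<forall>y \<in> Obj D.
           bij_betw (\<Phi> x y) (Hom D (OMap F x) y) (Hom C x (OMap G y))) \<and>
        (\<forall>x \<in> Obj C. \<forall>x' \<in> Obj C. \<forall>y \<in> Obj D. \<forall>y' \<in> Obj D.
         \<forall>f \<in> Hom C x' x. \<forall>k \<in> Hom D y y'. \<forall>g \<in> Hom D (OMap F x) y.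
           \<Phi> x' y' (k \<cdot>\<^bsub>D\<^esub> (g \<cdot>\<^bsub>D\<^esub> AMap F f)) = AMap G k \<cdot>\<^bsub>C\<^esub> (\<Phi> x y g \<cdot>\<^bsub>C\<^esub> f)))"


section \<open>Pullbacks, slices and exponentiable morphisms\<close>

text \<open>\<open>is_pullback C f g p q\<close>: the square \<open>f \<cdot> p = g \<cdot> q\<close> is a pullback square.\<close>

definition is_pullback :: "('o, 'm) cat \<Rightarrow> 'm \<Rightarrow> 'm \<Rightarrow> 'm \<Rightarrow> 'm \<Rightarrow> bool" where
  "is_pullback C f g p q \<longleftrightarrow>
     f \<in> Arr C \<and> g \<in> Arr C \<and> Cod C f = Cod C g \<and>
     p \<in> Hom C (Dom C p) (Dom C f) \<and> q \<in> Hom C (Dom C p) (Dom C g) \<and>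
     f \<cdot>\<^bsub>C\<^esub> p = g \<cdot>\<^bsub>C\<^esub> q \<and>
     (\<forall>w \<in> Obj C. \<forall>a \<in> Hom C w (Dom C f). \<forall>b \<in> Hom C w (Dom C g).
        f \<cdot>\<^bsub>C\<^esub> a = g \<cdot>\<^bsub>C\<^esub> b \<longrightarrow>
        (\<exists>!u. u \<in> Hom C w (Dom C p) \<and> p \<cdot>\<^bsub>C\<^esub> u = a \<and> q \<cdot>\<^bsub>C\<^esub> u = b))"

definition has_pullbacks :: "('o, 'm) cat \<Rightarrow> bool" where
  "has_pullbacks C \<longleftrightarrow>
     (\<forall>f \<in> Arr C. \<forall>g \<in> Arr C. Cod C f = Cod C g \<longrightarrow> (\<exists>p q. is_pullback C f g p q))"

text \<open>An arrow \<open>x \<rightarrow> y\<close> of the slice over \<open>A\<close> is a triple \<open>(x, h, y)\<close>, so that it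
  determines its domain and codomain.\<close>

definition slice :: "('o, 'm) cat \<Rightarrow> 'o \<Rightarrow> ('m, 'm \<times> 'm \<times> 'm) cat" where
  "slice C A =
     \<lparr> Obj = {x \<in> Arr C. Cod C x = A},
       Arr = {(x, h, y). x \<in> Arr C \<and> Cod C x = A \<and> y \<in> Arr C \<and> Cod C y = A \<and>
                h \<in> Hom C (Dom C x) (Dom C y) \<and> y \<cdot>\<^bsub>C\<^esub> h = x},
       Dom = (\<lambda>(x, h, y). x),
       Cod = (\<lambda>(x, h, y). y),
       Id = (\<lambda>x. (x, Id C (Dom C x), x)),
       Comp = (\<lambda>(y', k, z) (x, h, y). (x, k \<cdot>\<^bsub>C\<^esub> h, z)) \<rparr>"

text \<open>The pullback functor along \<open>f : B \<rightarrow> A\<close>, for a choice of pullback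
  \<open>B \<leftarrow> B \<times>\<^sub>A X \<rightarrow> X\<close> of every \<open>x : X \<rightarrow> A\<close> along \<open>f\<close>.\<close>

definition chosen_pullback :: "('o, 'm) cat \<Rightarrow> 'm \<Rightarrow> 'm \<Rightarrow> 'm \<times> 'm" where
  "chosen_pullback C f x = (SOME (p, q). is_pullback C f x p q)"

definition pullback_functor ::
  "('o, 'm) cat \<Rightarrow> 'm \<Rightarrow> ('m, 'm \<times> 'm \<times> 'm, 'm, 'm \<times> 'm \<times> 'm) functor_data" where
  "pullback_functor C f =
     \<lparr> OMap = (\<lambda>x. fst (chosen_pullback C f x)),
       AMap = (\<lambda>(x, h, y).
         let (p, q) = chosen_pullback C f x; (p', q') = chosen_pullback C f y
         in (p, (THE u. u \<in> Hom C (Dom C p) (Dom C p') \<and>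
                    p' \<cdot>\<^bsub>C\<^esub> u = p \<and> q' \<cdot>\<^bsub>C\<^esub> u = h \<cdot>\<^bsub>C\<^esub> q), p')) \<rparr>"

definition exponentiable :: "('o, 'm) cat \<Rightarrow> 'm \<Rightarrow> bool" where
  "exponentiable C f \<longleftrightarrow> f \<in> Arr C \<and>
     (\<exists>G. is_right_adjoint (slice C (Cod C f)) (slice C (Dom C f)) (pullback_functor C f) G)"


section \<open>The category of polynomials\<close>

text \<open>A representative of a morphism \<open>\<phi>\<close> from \<open>p : P\<^sub>* \<rightarrow> P\<close> to \<open>q : Q\<^sub>* \<rightarrow> Q\<close> consists of
  \<open>base = \<phi>\<^sub>1 : P \<rightarrow> Q\<close>, a pullback \<open>P \<times>\<^sub>Q Q\<^sub>*\<close> of \<open>q\<close> along \<open>\<phi>\<^sub>1\<close>, given by its projections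
  \<open>prj1\<close> to \<open>P\<close> and \<open>prj2\<close> to \<open>Q\<^sub>*\<close>, and the arrow \<open>sharp : P \<times>\<^sub>Q Q\<^sub>* \<rightarrow> P\<^sub>*\<close> over \<open>P\<close>.\<close>

record 'm poly_data =
  base :: 'm
  prj1 :: 'm
  prj2 :: 'm
  sharp :: 'm

definition poly_datas :: "('o, 'm) cat \<Rightarrow> 'm \<Rightarrow> 'm \<Rightarrow> 'm poly_data set" where
  "poly_datas C p q =
     {\<phi>. base \<phi> \<in> Hom C (Cod C p) (Cod C q) \<and>
         is_pullback C (base \<phi>) q (prj1 \<phi>) (prj2 \<phi>) \<and>
         sharp \<phi> \<in> Hom C (Dom C (prj1 \<phi>)) (Dom C p) \<and>
         p \<cdot>\<^bsub>C\<^esub> sharp \<phi> = prj1 \<phi>}"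

definition poly_equiv :: "('o, 'm) cat \<Rightarrow> 'm \<Rightarrow> 'm \<Rightarrow> ('m poly_data \<times> 'm poly_data) set" where
  "poly_equiv C p q =
     {(\<phi>, \<phi>'). \<phi> \<in> poly_datas C p q \<and> \<phi>' \<in> poly_datas C p q \<and> base \<phi> = base \<phi>' \<and>
        (\<exists>\<theta> \<in> Hom C (Dom C (prj1 \<phi>)) (Dom C (prj1 \<phi>')). is_iso C \<theta> \<and>
           prj1 \<phi>' \<cdot>\<^bsub>C\<^esub> \<theta> = prj1 \<phi> \<and> prj2 \<phi>' \<cdot>\<^bsub>C\<^esub> \<theta> = prj2 \<phi> \<and> sharp \<phi>' \<cdot>\<^bsub>C\<^esub> \<theta> = sharp \<phi>)}"

text \<open>\<open>poly_composite C r \<phi> \<psi> \<chi>\<close>: \<open>\<chi>\<close> represents the composite of \<open>\<phi> : p \<rightarrow> q\<close> and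
  \<open>\<psi> : q \<rightarrow> r\<close>. Here \<open>s1\<close>, \<open>s2\<close> are the projections of a pullback \<open>P \<times>\<^sub>Q (Q \<times>\<^sub>R R\<^sub>*)\<close>,
  \<open>u\<close> is the arrow \<open>P \<times>\<^sub>Q \<psi>\<^sup>\<sharp>\<close> to \<open>P \<times>\<^sub>Q Q\<^sub>*\<close>, and \<open>k\<close> is the canonical isomorphism
  \<open>P \<times>\<^sub>R R\<^sub>* \<cong> P \<times>\<^sub>Q (Q \<times>\<^sub>R R\<^sub>*)\<close>.\<close>

definition poly_composite ::
  "('o, 'm) cat \<Rightarrow> 'm \<Rightarrow> 'm poly_data \<Rightarrow> 'm poly_data \<Rightarrow> 'm poly_data \<Rightarrow> bool" where
  "poly_composite C r \<phi> \<psi> \<chi> \<longleftrightarrow>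
     base \<chi> = base \<psi> \<cdot>\<^bsub>C\<^esub> base \<phi> \<and>
     is_pullback C (base \<chi>) r (prj1 \<chi>) (prj2 \<chi>) \<and>
     (\<exists>s1 s2 u k.
        is_pullback C (base \<phi>) (prj1 \<psi>) s1 s2 \<and>
        u \<in> Hom C (Dom C s1) (Dom C (prj1 \<phi>)) \<and>
        prj1 \<phi> \<cdot>\<^bsub>C\<^esub> u = s1 \<and> prj2 \<phi> \<cdot>\<^bsub>C\<^esub> u = sharp \<psi> \<cdot>\<^bsub>C\<^esub> s2 \<and>
        k \<in> Hom C (Dom C (prj1 \<chi>)) (Dom C s1) \<and> is_iso C k \<and>
        s1 \<cdot>\<^bsub>C\<^esub> k = prj1 \<chi> \<and> prj2 \<psi> \<cdot>\<^bsub>C\<^esub> (s2 \<cdot>\<^bsub>C\<^esub> k) = prj2 \<chi> \<and>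
        sharp \<chi> = sharp \<phi> \<cdot>\<^bsub>C\<^esub> (u \<cdot>\<^bsub>C\<^esub> k))"

text \<open>The identity on \<open>p\<close> uses the pullback \<open>P \<times>\<^sub>P P\<^sub>* = P\<^sub>*\<close>, with projections \<open>p\<close> and the
  identity.\<close>

definition poly_id :: "('o, 'm) cat \<Rightarrow> 'm \<Rightarrow> 'm poly_data" where
  "poly_id C p =
     \<lparr> base = Id C (Cod C p), prj1 = p, prj2 = Id C (Dom C p), sharp = Id C (Dom C p) \<rparr>"

text \<open>An arrow \<open>p \<rightarrow> q\<close> is a triple \<open>(p, \<Phi>, q)\<close> with \<open>\<Phi>\<close> an equivalence class. The composite of
  two classes consists of all composites of all their representatives; that this is again a
  single equivalence class expresses that composition is well defined.\<close>

definition Poly :: "('o, 'm) cat \<Rightarrow> ('m, 'm \<times> 'm poly_data set \<times> 'm) cat" where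
  "Poly C =
     \<lparr> Obj = {p. exponentiable C p},
       Arr = {(p, \<Phi>, q). exponentiable C p \<and> exponentiable C q \<and>
                \<Phi> \<in> poly_datas C p q // poly_equiv C p q},
       Dom = (\<lambda>(p, \<Phi>, q). p),
       Cod = (\<lambda>(p, \<Phi>, q). q),
       Id = (\<lambda>p. (p, poly_equiv C p p `` {poly_id C p}, p)),
       Comp = (\<lambda>(q', \<Psi>, r) (p, \<Phi>, q).
         (p, {\<chi>. \<exists>\<phi> \<in> \<Phi>. \<exists>\<psi> \<in> \<Psi>. poly_composite C r \<phi> \<psi> \<chi>}, r)) \<rparr>"

end

(* A morphism from p to q is determined by its base and by its action on generalized elements: it
   sends a : w -> P and b : w -> Q_* with base . a = q . b to sharp . <a, b> : w -> P_*. Equivalence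
   of representatives amounts to equality of the bases and of the actions, and composites are given
   by (a, c) |-> phi (a, psi (phi_1 a, c)). So the composite class does not depend on any choice of
   pullbacks, and the category laws hold because both sides have the same base and action. *)
theory Submission
  imports Defs
begin

section \<open>Pullbacks\<close>

text \<open>Such pairs \<open>a\<close>, \<open>b\<close> are the generalized elements at stage
  \<open>w\<close> of a pullback of \<open>f\<close> and \<open>g\<close>, described without
  choosing one.\<close>

definition cone :: "('o, 'm) cat \<Rightarrow> 'm \<Rightarrow> 'm \<Rightarrow> 'o \<Rightarrow> 'm \<Rightarrow> 'm \<Rightarrow> bool" where
  "cone C f g w a b \<longleftrightarrow>
     w \<in> Obj C \<and> a \<in> Hom C w (Dom C f) \<and> b \<in> Hom C w (Dom C g) \<and> f \<cdot>\<^bsub>C\<^esub> a = g \<cdot>\<^bsub>C\<^esub> b"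

lemma Hom_Arr: "f \<in> Arr C \<Longrightarrow> f \<in> Hom C (Dom C f) (Cod C f)"
  by (simp add: Hom_def)

lemma HomD:
  assumes "f \<in> Hom C x y"
  shows "f \<in> Arr C" "Dom C f = x" "Cod C f = y"
  using assms by (auto simp: Hom_def)

context category
begin

lemma Hom_Obj:
  assumes "f \<in> Hom C x y"
  shows "x \<in> Obj C" "y \<in> Obj C"
  using assms Dom_Obj Cod_Obj by (auto simp: Hom_def)

lemma pullbackD:
  assumes "is_pullback C f g p q"
  shows "f \<in> Hom C (Dom C f) (Cod C f)" "g \<in> Hom C (Dom C g) (Cod C f)"
    "p \<in> Hom C (Dom C p) (Dom C f)" "q \<in> Hom C (Dom C p) (Dom C g)" "f \<cdot> p = g \<cdot> q"
  using assms by (auto simp: is_pullback_def Hom_def)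

lemma pullback_cone: "is_pullback C f g p q \<Longrightarrow> cone C f g (Dom C p) p q"
  using pullbackD[of f g p q] Hom_Obj(1)[OF pullbackD(3)[of f g p q]] by (simp add: cone_def)

lemma cone_comp:
  assumes "cone C f g w a b" "f \<in> Arr C" "g \<in> Arr C" "u \<in> Hom C v w"
  shows "cone C f g v (a \<cdot> u) (b \<cdot> u)"
proof -
  have ab: "a \<in> Hom C w (Dom C f)" "b \<in> Hom C w (Dom C g)" "f \<cdot> a = g \<cdot> b"
    using assms(1) by (simp_all add: cone_def)
  show ?thesis
    using ab(3) Comp_assoc[OF assms(4) ab(1) Hom_Arr[OF assms(2)]]
      Comp_assoc[OF assms(4) ab(2) Hom_Arr[OF assms(3)]]
      Comp_Hom[OF assms(4) ab(1)] Comp_Hom[OF assms(4) ab(2)] Hom_Obj(1)[OF assms(4)]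
    by (simp add: cone_def)
qed

lemma pullback_lift:
  assumes "is_pullback C f g p q" "cone C f g w a b"
  obtains u where "u \<in> Hom C w (Dom C p)" "p \<cdot> u = a" "q \<cdot> u = b"
  using assms unfolding is_pullback_def cone_def by meson

text \<open>The pair \<open>p \<cdot> u\<close>, \<open>q \<cdot> u\<close> is itself a cone, and
  both \<open>u\<close> and \<open>v\<close> factor it. Thus the projections are jointly
  monic.\<close>

lemma pullback_eqI:
  assumes pb: "is_pullback C f g p q" and u: "u \<in> Hom C w (Dom C p)" and v: "v \<in> Hom C w (Dom C p)"
    and eq: "p \<cdot> u = p \<cdot> v" "q \<cdot> u = q \<cdot> v"
  shows "u = v"
proof -
  have "cone C f g w (p \<cdot> u) (q \<cdot> u)"
    using cone_comp[OF pullback_cone[OF pb] HomD(1) HomD(1) u] pullbackD(1,2)[OF pb] by blast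
  then have "\<exists>!x. x \<in> Hom C w (Dom C p) \<and> p \<cdot> x = p \<cdot> u \<and> q \<cdot> x = q \<cdot> u"
    using pb unfolding is_pullback_def cone_def by blast
  then show ?thesis
    using u v eq by metis
qed

text \<open>Splits unique factorization into existence of a lift and joint monicity, which are
  checked separately for pasted squares and identity squares.\<close>

lemma is_pullbackI:
  assumes "f \<in> Hom C x z" "g \<in> Hom C y z" "p \<in> Hom C v x" "q \<in> Hom C v y" "f \<cdot> p = g \<cdot> q"
    and "\<And>w a b. cone C f g w a b \<Longrightarrow> \<exists>u \<in> Hom C w v. p \<cdot> u = a \<and> q \<cdot> u = b"
    and "\<And>w u u'. u \<in> Hom C w v \<Longrightarrow> u' \<in> Hom C w v \<Longrightarrow> p \<cdot> u = p \<cdot> u' \<Longrightarrow> q \<cdot> u = q \<cdot> u' \<Longrightarrow> u = u'"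
  shows "is_pullback C f g p q"
proof -
  have "\<exists>!u. u \<in> Hom C w v \<and> p \<cdot> u = a \<and> q \<cdot> u = b"
    if c: "cone C f g w a b" for w a b
    using assms(6)[OF c] assms(7) by metis
  moreover have "Dom C f = x" "Dom C g = y" "Dom C p = v"
    by (rule HomD(2), fact)+
  ultimately show ?thesis
    using assms(1-5) HomD unfolding is_pullback_def cone_def by metis
qed

text \<open>Each square lifts to the other. The two composite lifts agree with identities after both
  projections, so joint monicity makes the lifts mutually inverse.\<close>

lemma pullback_unique:
  assumes pb: "is_pullback C f g p q" and pb': "is_pullback C f g p' q'"
  obtains k where "k \<in> Hom C (Dom C p) (Dom C p')" "is_iso C k" "p' \<cdot> k = p" "q' \<cdot> k = q"
proof -
  note P = pullbackD[OF pb] and P' = pullbackD[OF pb']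
  obtain k where k: "k \<in> Hom C (Dom C p) (Dom C p')" "p' \<cdot> k = p" "q' \<cdot> k = q"
    using pullback_lift[OF pb' pullback_cone[OF pb]] by blast
  obtain l where l: "l \<in> Hom C (Dom C p') (Dom C p)" "p \<cdot> l = p'" "q \<cdot> l = q'"
    using pullback_lift[OF pb pullback_cone[OF pb']] by blast
  have "l \<cdot> k = Id C (Dom C p)"
    using Comp_assoc[OF k(1) l(1) P(3)] Comp_assoc[OF k(1) l(1) P(4)] Comp_Id[OF P(3)] Comp_Id[OF P(4)] k l
    by (intro pullback_eqI[OF pb Comp_Hom[OF k(1) l(1)] Id_Hom[OF Hom_Obj(1)[OF P(3)]]]) simp_all
  moreover have "k \<cdot> l = Id C (Dom C p')"
    using Comp_assoc[OF l(1) k(1) P'(3)] Comp_assoc[OF l(1) k(1) P'(4)] Comp_Id[OF P'(3)] Comp_Id[OF P'(4)] k l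
    by (intro pullback_eqI[OF pb' Comp_Hom[OF l(1) k(1)] Id_Hom[OF Hom_Obj(1)[OF P'(3)]]]) simp_all
  ultimately have "is_iso C k"
    using k(1) l(1) unfolding is_iso_def by (auto simp: Hom_def)
  with k that show thesis by blast
qed

text \<open>The pasting law. It exhibits the iterated pullback in a composite as a pullback of
  \<open>r\<close> along the composite base, which is where the canonical isomorphism comes
  from.\<close>

lemma pullback_paste:
  assumes pb1: "is_pullback C f p1 s1 s2" and pb2: "is_pullback C g r p1 p2"
  shows "is_pullback C (g \<cdot> f) r s1 (p2 \<cdot> s2)"
proof (rule is_pullbackI)
  note P = pullbackD[OF pb1] and Q = pullbackD[OF pb2]
  have f: "f \<in> Hom C (Dom C f) (Dom C g)"
    using P(1,2) Q(3) by (auto simp: Hom_def)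
  show "g \<cdot> f \<in> Hom C (Dom C f) (Cod C g)" "r \<in> Hom C (Dom C r) (Cod C g)"
    "s1 \<in> Hom C (Dom C s1) (Dom C f)" "p2 \<cdot> s2 \<in> Hom C (Dom C s1) (Dom C r)"
    using Comp_Hom[OF f Q(1)] Q(2) P(3) Comp_Hom[OF P(4) Q(4)] by simp_all
  show "(g \<cdot> f) \<cdot> s1 = r \<cdot> (p2 \<cdot> s2)"
    using Comp_assoc[OF P(3) f Q(1)] Comp_assoc[OF P(4) Q(3,1)] Comp_assoc[OF P(4) Q(4,2)] P(5) Q(5)
    by simp
  fix w
  {
    fix a b
    assume c: "cone C (g \<cdot> f) r w a b"
    then have a: "w \<in> Obj C" "a \<in> Hom C w (Dom C f)" "b \<in> Hom C w (Dom C r)" "(g \<cdot> f) \<cdot> a = r \<cdot> b"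
      using HomD(2)[OF Comp_Hom[OF f Q(1)]] by (auto simp: cone_def)
    \<comment> \<open>The lift is built in two stages: first \<open>v\<close> into the pullback of
      \<open>g\<close> and \<open>r\<close>, then \<open>u\<close> into that of \<open>f\<close> and
      \<open>p1\<close>.\<close>
    then have "cone C g r w (f \<cdot> a) b"
      using Comp_assoc[OF a(2) f Q(1)] Comp_Hom[OF a(2) f] by (simp add: cone_def)
    then obtain v where v: "v \<in> Hom C w (Dom C p1)" "p1 \<cdot> v = f \<cdot> a" "p2 \<cdot> v = b"
      using pullback_lift[OF pb2] by blast
    then have "cone C f p1 w a v"
      using a by (simp add: cone_def)
    then obtain u where u: "u \<in> Hom C w (Dom C s1)" "s1 \<cdot> u = a" "s2 \<cdot> u = v"
      using pullback_lift[OF pb1] by blast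
    then show "\<exists>u \<in> Hom C w (Dom C s1). s1 \<cdot> u = a \<and> (p2 \<cdot> s2) \<cdot> u = b"
      using Comp_assoc[OF u(1) P(4) Q(4)] v(3) by auto
  }
  fix u u'
  assume u: "u \<in> Hom C w (Dom C s1)" and u': "u' \<in> Hom C w (Dom C s1)"
    and e: "s1 \<cdot> u = s1 \<cdot> u'" "(p2 \<cdot> s2) \<cdot> u = (p2 \<cdot> s2) \<cdot> u'"
  \<comment> \<open>Only agreement after \<open>p2\<close> is given directly; agreement after
    \<open>p1\<close> follows from \<open>p1 \<cdot> s2 = f \<cdot> s1\<close> and agreement after
    \<open>s1\<close>.\<close>
  have "s2 \<cdot> u = s2 \<cdot> u'"
  proof (rule pullback_eqI[OF pb2])
    show "s2 \<cdot> u \<in> Hom C w (Dom C p1)" "s2 \<cdot> u' \<in> Hom C w (Dom C p1)"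
      using Comp_Hom[OF u P(4)] Comp_Hom[OF u' P(4)] .
    show "p1 \<cdot> (s2 \<cdot> u) = p1 \<cdot> (s2 \<cdot> u')"
      using Comp_assoc[OF u P(4) Q(3)] Comp_assoc[OF u' P(4) Q(3)] Comp_assoc[OF u P(3) f]
        Comp_assoc[OF u' P(3) f] P(5) e(1) by simp
    show "p2 \<cdot> (s2 \<cdot> u) = p2 \<cdot> (s2 \<cdot> u')"
      using Comp_assoc[OF u P(4) Q(4)] Comp_assoc[OF u' P(4) Q(4)] e(2) by simp
  qed
  then show "u = u'"
    using pullback_eqI[OF pb1 u u' e(1)] by blast
qed

lemma pullback_Id:
  assumes p: "p \<in> Arr C"
  shows "is_pullback C (Id C (Cod C p)) p p (Id C (Dom C p))"
proof (rule is_pullbackI)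
  note P = Hom_Arr[OF p]
  note I = Id_Hom[OF Hom_Obj(2)[OF P]] and J = Id_Hom[OF Hom_Obj(1)[OF P]]
  show "Id C (Cod C p) \<in> Hom C (Cod C p) (Cod C p)" "p \<in> Hom C (Dom C p) (Cod C p)"
    "p \<in> Hom C (Dom C p) (Cod C p)" "Id C (Dom C p) \<in> Hom C (Dom C p) (Dom C p)"
    by (fact I P J)+
  show "Id C (Cod C p) \<cdot> p = p \<cdot> Id C (Dom C p)"
    using Comp_Id[OF P] Id_Comp[OF P] by simp
  \<comment> \<open>The cone condition reads \<open>a = p \<cdot> b\<close>, so \<open>b\<close>
    itself is the lift.\<close>
  show "\<exists>u \<in> Hom C w (Dom C p). p \<cdot> u = a \<and> Id C (Dom C p) \<cdot> u = b"
    if "cone C (Id C (Cod C p)) p w a b" for w a b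
    using that HomD(2)[OF I] Id_Comp unfolding cone_def by metis
  show "u = u'" if "u \<in> Hom C w (Dom C p)" "u' \<in> Hom C w (Dom C p)"
    "Id C (Dom C p) \<cdot> u = Id C (Dom C p) \<cdot> u'" for w u u'
    using that Id_Comp by metis
qed

end


section \<open>The action of a morphism of polynomials on generalized elements\<close>

text \<open>The stage is read off as \<open>Dom C a\<close>. The description denotes a genuine lift
  when \<open>a\<close>, \<open>b\<close> form a cone over \<open>base \<phi>\<close> and the
  codomain polynomial; otherwise the value carries no meaning.\<close>

definition poly_act :: "('o, 'm) cat \<Rightarrow> 'm poly_data \<Rightarrow> 'm \<Rightarrow> 'm \<Rightarrow> 'm" where
  "poly_act C \<phi> a b = sharp \<phi> \<cdot>\<^bsub>C\<^esub>
     (THE u. u \<in> Hom C (Dom C a) (Dom C (prj1 \<phi>)) \<and> prj1 \<phi> \<cdot>\<^bsub>C\<^esub> u = a \<and> prj2 \<phi> \<cdot>\<^bsub>C\<^esub> u = b)"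

context category
begin

lemma poly_datasD:
  assumes "\<phi> \<in> poly_datas C p q"
  shows "base \<phi> \<in> Hom C (Cod C p) (Cod C q)" "is_pullback C (base \<phi>) q (prj1 \<phi>) (prj2 \<phi>)"
    "sharp \<phi> \<in> Hom C (Dom C (prj1 \<phi>)) (Dom C p)" "p \<cdot> sharp \<phi> = prj1 \<phi>"
    "prj1 \<phi> \<in> Hom C (Dom C (prj1 \<phi>)) (Cod C p)" "prj2 \<phi> \<in> Hom C (Dom C (prj1 \<phi>)) (Dom C q)"
    "Dom C (base \<phi>) = Cod C p" "Cod C (base \<phi>) = Cod C q"
  using assms pullbackD[of "base \<phi>" q "prj1 \<phi>" "prj2 \<phi>"] by (auto simp: poly_datas_def Hom_def)

text \<open>Lifts are unique, so any arrow with the right projections may replace the description;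
  actions are computed this way below.\<close>

lemma poly_act_eq:
  assumes \<phi>: "\<phi> \<in> poly_datas C p q" and u: "u \<in> Hom C w (Dom C (prj1 \<phi>))"
    and a: "prj1 \<phi> \<cdot> u = a" and b: "prj2 \<phi> \<cdot> u = b"
  shows "poly_act C \<phi> a b = sharp \<phi> \<cdot> u"
proof -
  note D = poly_datasD[OF \<phi>]
  have "Dom C a = w"
    using HomD(2)[OF Comp_Hom[OF u D(5)]] a by simp
  then have "(THE v. v \<in> Hom C (Dom C a) (Dom C (prj1 \<phi>)) \<and> prj1 \<phi> \<cdot> v = a \<and> prj2 \<phi> \<cdot> v = b) = u"
    using u a b pullback_eqI[OF D(2)] by (intro the_equality) auto
  then show ?thesis
    by (simp add: poly_act_def)
qed

text \<open>The projections form the universal element, whose lift is the identity. As in the Yoneda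
  lemma, the action therefore determines \<open>sharp \<phi>\<close>.\<close>

lemma poly_act_projections:
  assumes "\<phi> \<in> poly_datas C p q"
  shows "poly_act C \<phi> (prj1 \<phi>) (prj2 \<phi>) = sharp \<phi>"
proof -
  note D = poly_datasD[OF assms]
  show ?thesis
    using poly_act_eq[OF assms Id_Hom[OF Hom_Obj(1)[OF D(5)]] Comp_Id[OF D(5)] Comp_Id[OF D(6)]]
      Comp_Id[OF D(3)] by simp
qed

lemma poly_act_lift:
  assumes \<phi>: "\<phi> \<in> poly_datas C p q" and c: "cone C (base \<phi>) q w a b"
  obtains u where "u \<in> Hom C w (Dom C (prj1 \<phi>))" "prj1 \<phi> \<cdot> u = a" "prj2 \<phi> \<cdot> u = b"
    "poly_act C \<phi> a b = sharp \<phi> \<cdot> u"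
  using pullback_lift[OF poly_datasD(2)[OF \<phi>] c] poly_act_eq[OF \<phi>] by metis

text \<open>Since \<open>p \<cdot> sharp \<phi>\<close> is the first projection, the result lies
  over \<open>a\<close>; hence it can serve as a leg of a further cone when actions are
  nested.\<close>

lemma poly_act_Hom:
  assumes \<phi>: "\<phi> \<in> poly_datas C p q" and p: "p \<in> Arr C" and c: "cone C (base \<phi>) q w a b"
  shows "poly_act C \<phi> a b \<in> Hom C w (Dom C p)" "p \<cdot> poly_act C \<phi> a b = a"
proof -
  note D = poly_datasD[OF \<phi>]
  obtain u where u: "u \<in> Hom C w (Dom C (prj1 \<phi>))" "prj1 \<phi> \<cdot> u = a"
    "poly_act C \<phi> a b = sharp \<phi> \<cdot> u"
    using poly_act_lift[OF \<phi> c] by blast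
  then show "poly_act C \<phi> a b \<in> Hom C w (Dom C p)"
    using D Comp_Hom by metis
  show "p \<cdot> poly_act C \<phi> a b = a"
    using u D Comp_assoc[OF u(1) D(3) Hom_Arr[OF p]] by metis
qed

text \<open>Composition with a compatible \<open>\<theta>\<close> carries lifts to lifts and so
  preserves the action. Conversely, uniqueness of pullbacks supplies \<open>\<theta>\<close>, and
  the action at the projections shows that it respects \<open>sharp\<close>.\<close>

lemma poly_equiv_iff:
  assumes \<phi>: "\<phi> \<in> poly_datas C p q" and \<phi>': "\<phi>' \<in> poly_datas C p q"
  shows "(\<phi>, \<phi>') \<in> poly_equiv C p q \<longleftrightarrow> base \<phi> = base \<phi>' \<and>
    (\<forall>w a b. cone C (base \<phi>) q w a b \<longrightarrow> poly_act C \<phi> a b = poly_act C \<phi>' a b)"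
    (is "?L \<longleftrightarrow> ?R")
proof
  note D = poly_datasD[OF \<phi>] and D' = poly_datasD[OF \<phi>']
  show ?R if ?L
  proof -
    obtain \<theta> where e: "base \<phi> = base \<phi>'" and
      \<theta>: "\<theta> \<in> Hom C (Dom C (prj1 \<phi>)) (Dom C (prj1 \<phi>'))" "prj1 \<phi>' \<cdot> \<theta> = prj1 \<phi>"
      "prj2 \<phi>' \<cdot> \<theta> = prj2 \<phi>" "sharp \<phi>' \<cdot> \<theta> = sharp \<phi>"
      using \<open>?L\<close> unfolding poly_equiv_def by blast
    have "poly_act C \<phi> a b = poly_act C \<phi>' a b" if c: "cone C (base \<phi>) q w a b" for w a b
    proof -
      obtain u where u: "u \<in> Hom C w (Dom C (prj1 \<phi>))" "prj1 \<phi> \<cdot> u = a" "prj2 \<phi> \<cdot> u = b"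
        "poly_act C \<phi> a b = sharp \<phi> \<cdot> u"
        using poly_act_lift[OF \<phi> c] by blast
      have "poly_act C \<phi>' a b = sharp \<phi>' \<cdot> (\<theta> \<cdot> u)"
        using Comp_assoc[OF u(1) \<theta>(1) D'(5)] Comp_assoc[OF u(1) \<theta>(1) D'(6)] u \<theta>
        by (intro poly_act_eq[OF \<phi>' Comp_Hom[OF u(1) \<theta>(1)]]) simp_all
      then show ?thesis
        using Comp_assoc[OF u(1) \<theta>(1) D'(3)] \<theta>(4) u(4) by simp
    qed
    with e show ?thesis by blast
  qed
  show ?L if R: ?R
  proof -
    have pb: "is_pullback C (base \<phi>) q (prj1 \<phi>') (prj2 \<phi>')"
      using D'(2) R by simp
    obtain \<theta> where \<theta>: "\<theta> \<in> Hom C (Dom C (prj1 \<phi>)) (Dom C (prj1 \<phi>'))" "is_iso C \<theta>"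
      "prj1 \<phi>' \<cdot> \<theta> = prj1 \<phi>" "prj2 \<phi>' \<cdot> \<theta> = prj2 \<phi>"
      using pullback_unique[OF D(2) pb] by blast
    \<comment> \<open>\<open>\<theta>\<close> is the lift of the projections of
      \<open>\<phi>\<close> into the pullback of \<open>\<phi>'\<close>.\<close>
    have "sharp \<phi>' \<cdot> \<theta> = poly_act C \<phi>' (prj1 \<phi>) (prj2 \<phi>)"
      using poly_act_eq[OF \<phi>' \<theta>(1)] \<theta> by simp
    also have "\<dots> = sharp \<phi>"
      using R pullback_cone[OF D(2)] poly_act_projections[OF \<phi>] by metis
    finally show ?thesis
      using \<phi> \<phi>' R \<theta> by (auto simp: poly_equiv_def)
  qed
qed


section \<open>Composition and identities\<close>

text \<open>Here \<open>u\<close> is the arrow \<open>P \<times>\<^sub>Q \<psi>\<^sup>\<sharp>\<close> and \<open>v\<close> a generalized element of \<open>P \<times>\<^sub>Q (Q \<times>\<^sub>R R\<^sub>*)\<close>.\<close>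

lemma poly_act_nested:
  assumes \<phi>: "\<phi> \<in> poly_datas C p q" and \<psi>: "\<psi> \<in> poly_datas C q r"
    and pb: "is_pullback C (base \<phi>) (prj1 \<psi>) s1 s2"
    and u: "u \<in> Hom C (Dom C s1) (Dom C (prj1 \<phi>))" "prj1 \<phi> \<cdot> u = s1" "prj2 \<phi> \<cdot> u = sharp \<psi> \<cdot> s2"
    and v: "v \<in> Hom C w (Dom C s1)" "s1 \<cdot> v = a" "prj2 \<psi> \<cdot> (s2 \<cdot> v) = c"
  shows "poly_act C \<phi> a (poly_act C \<psi> (base \<phi> \<cdot> a) c) = sharp \<phi> \<cdot> (u \<cdot> v)"
proof -
  note D = poly_datasD[OF \<phi>] and E = poly_datasD[OF \<psi>] and P = pullbackD[OF pb]
  \<comment> \<open>Commutativity of the chosen square shows that \<open>s2 \<cdot> v\<close> is the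
    lift used by the inner action.\<close>
  have "prj1 \<psi> \<cdot> (s2 \<cdot> v) = base \<phi> \<cdot> a"
    using Comp_assoc[OF v(1) P(4,2)] Comp_assoc[OF v(1) P(3,1)] P(5) v(2) by simp
  then have "poly_act C \<psi> (base \<phi> \<cdot> a) c = sharp \<psi> \<cdot> (s2 \<cdot> v)"
    using poly_act_eq[OF \<psi> Comp_Hom[OF v(1) P(4)]] v(3) by blast
  \<comment> \<open>The defining equation of \<open>u\<close> makes \<open>u \<cdot> v\<close> the
    lift used by the outer action.\<close>
  also have "\<dots> = prj2 \<phi> \<cdot> (u \<cdot> v)"
    using Comp_assoc[OF v(1) u(1) D(6)] Comp_assoc[OF v(1) P(4) E(3)] u(3) by simp
  finally show ?thesis
    using poly_act_eq[OF \<phi> Comp_Hom[OF v(1) u(1)]] Comp_assoc[OF v(1) u(1) D(5)] u(2) v(2) by simp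
qed

text \<open>The arrow \<open>u\<close> is a lift: \<open>sharp \<psi>\<close> lies over the base of
  \<open>q\<close>, so \<open>q \<cdot> (sharp \<psi> \<cdot> s2) = prj1 \<psi> \<cdot> s2 = base
  \<phi> \<cdot> s1\<close>.\<close>

lemma composite_square:
  assumes hp: "has_pullbacks C" and \<phi>: "\<phi> \<in> poly_datas C p q" and \<psi>: "\<psi> \<in> poly_datas C q r"
    and q: "q \<in> Arr C"
  obtains s1 s2 u where "is_pullback C (base \<phi>) (prj1 \<psi>) s1 s2"
    "u \<in> Hom C (Dom C s1) (Dom C (prj1 \<phi>))" "prj1 \<phi> \<cdot> u = s1" "prj2 \<phi> \<cdot> u = sharp \<psi> \<cdot> s2"
proof -
  note D = poly_datasD[OF \<phi>] and E = poly_datasD[OF \<psi>]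
  have "Cod C (base \<phi>) = Cod C (prj1 \<psi>)" "base \<phi> \<in> Arr C" "prj1 \<psi> \<in> Arr C"
    using D(1) E(5) by (auto simp: Hom_def)
  then obtain s1 s2 where pb: "is_pullback C (base \<phi>) (prj1 \<psi>) s1 s2"
    using hp unfolding has_pullbacks_def by blast
  note P = pullbackD[OF pb]
  have "cone C (base \<phi>) q (Dom C s1) s1 (sharp \<psi> \<cdot> s2)"
    using P E(3,4) Hom_Obj(1)[OF P(3)] Comp_Hom[OF P(4) E(3)]
      Comp_assoc[OF P(4) E(3) Hom_Arr[OF q]] by (simp add: cone_def)
  then show thesis
    using pullback_lift[OF D(2)] pb that by metis
qed

text \<open>The pasted square is taken as the pullback of the composite, so that the canonical
  isomorphism becomes an identity.\<close>

lemma poly_composite_exists: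
  assumes hp: "has_pullbacks C" and \<phi>: "\<phi> \<in> poly_datas C p q" and \<psi>: "\<psi> \<in> poly_datas C q r"
    and q: "q \<in> Arr C"
  obtains \<chi> where "poly_composite C r \<phi> \<psi> \<chi>"
proof -
  note D = poly_datasD[OF \<phi>] and E = poly_datasD[OF \<psi>]
  obtain s1 s2 u where pb: "is_pullback C (base \<phi>) (prj1 \<psi>) s1 s2"
    and u: "u \<in> Hom C (Dom C s1) (Dom C (prj1 \<phi>))" "prj1 \<phi> \<cdot> u = s1" "prj2 \<phi> \<cdot> u = sharp \<psi> \<cdot> s2"
    using composite_square[OF hp \<phi> \<psi> q] by blast
  note P = pullbackD[OF pb]
  let ?k = "Id C (Dom C s1)"
  have k: "?k \<in> Hom C (Dom C s1) (Dom C s1)"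
    using Id_Hom Hom_Obj(1)[OF P(3)] by blast
  then have iso: "is_iso C ?k"
    using Comp_Id[OF k] by (auto simp: is_iso_def Hom_def)
  have "s1 \<cdot> ?k = s1" "prj2 \<psi> \<cdot> (s2 \<cdot> ?k) = prj2 \<psi> \<cdot> s2" "sharp \<phi> \<cdot> u = sharp \<phi> \<cdot> (u \<cdot> ?k)"
    using Comp_Id[OF P(3)] Comp_Id[OF P(4)] Comp_Id[OF u(1)] by simp_all
  then have "poly_composite C r \<phi> \<psi> \<lparr>base = base \<psi> \<cdot> base \<phi>, prj1 = s1, prj2 = prj2 \<psi> \<cdot> s2,
      sharp = sharp \<phi> \<cdot> u\<rparr>"
    using pb u k iso pullback_paste[OF pb E(2)]
    unfolding poly_composite_def poly_data.simps by blast
  with that show thesis .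
qed

text \<open>Eliminates the auxiliary \<open>s1\<close>, \<open>s2\<close>, \<open>u\<close>,
  \<open>k\<close> in favour of base and action. Forwards, lifts are transported along
  \<open>k\<close> and the nested action is computed; backwards, \<open>k\<close> comes from
  uniqueness of pullbacks and \<open>sharp \<chi>\<close> from the action at the
  projections.\<close>

lemma poly_composite_iff:
  assumes hp: "has_pullbacks C" and \<phi>: "\<phi> \<in> poly_datas C p q" and \<psi>: "\<psi> \<in> poly_datas C q r"
    and p: "p \<in> Arr C" and q: "q \<in> Arr C"
  shows "poly_composite C r \<phi> \<psi> \<chi> \<longleftrightarrow> \<chi> \<in> poly_datas C p r \<and> base \<chi> = base \<psi> \<cdot> base \<phi> \<and>
    (\<forall>w a c. cone C (base \<chi>) r w a c \<longrightarrow>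
       poly_act C \<chi> a c = poly_act C \<phi> a (poly_act C \<psi> (base \<phi> \<cdot> a) c))"
    (is "?L \<longleftrightarrow> ?R")
proof
  note D = poly_datasD[OF \<phi>] and E = poly_datasD[OF \<psi>]
  show ?R if ?L
  proof -
    obtain s1 s2 u k where pb: "is_pullback C (base \<phi>) (prj1 \<psi>) s1 s2"
      and u: "u \<in> Hom C (Dom C s1) (Dom C (prj1 \<phi>))" "prj1 \<phi> \<cdot> u = s1" "prj2 \<phi> \<cdot> u = sharp \<psi> \<cdot> s2"
      and k: "k \<in> Hom C (Dom C (prj1 \<chi>)) (Dom C s1)" "s1 \<cdot> k = prj1 \<chi>"
        "prj2 \<psi> \<cdot> (s2 \<cdot> k) = prj2 \<chi>"
      and \<chi>: "sharp \<chi> = sharp \<phi> \<cdot> (u \<cdot> k)" "base \<chi> = base \<psi> \<cdot> base \<phi>"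
        "is_pullback C (base \<chi>) r (prj1 \<chi>) (prj2 \<chi>)"
      using \<open>?L\<close> unfolding poly_composite_def by blast
    note P = pullbackD[OF pb]
    have uk: "u \<cdot> k \<in> Hom C (Dom C (prj1 \<chi>)) (Dom C (prj1 \<phi>))"
      using Comp_Hom[OF k(1) u(1)] .
    have "p \<cdot> sharp \<chi> = prj1 \<phi> \<cdot> (u \<cdot> k)"
      using Comp_assoc[OF uk D(3) Hom_Arr[OF p]] \<chi>(1) D(4) by simp
    also have "\<dots> = prj1 \<chi>"
      using Comp_assoc[OF k(1) u(1) D(5)] u k by simp
    finally have mem: "\<chi> \<in> poly_datas C p r"
      using Comp_Hom[OF D(1) E(1)] Comp_Hom[OF uk D(3)] \<chi> by (simp add: poly_datas_def)
    have "poly_act C \<chi> a c = poly_act C \<phi> a (poly_act C \<psi> (base \<phi> \<cdot> a) c)"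
      if c: "cone C (base \<chi>) r w a c" for w a c
    proof -
      obtain v where v: "v \<in> Hom C w (Dom C (prj1 \<chi>))" "prj1 \<chi> \<cdot> v = a" "prj2 \<chi> \<cdot> v = c"
        "poly_act C \<chi> a c = sharp \<chi> \<cdot> v"
        using poly_act_lift[OF mem c] by blast
      \<comment> \<open>\<open>k \<cdot> v\<close> represents the pair \<open>a\<close>,
        \<open>c\<close> in the iterated pullback, as \<open>poly_act_nested\<close>
        requires.\<close>
      have kv: "k \<cdot> v \<in> Hom C w (Dom C s1)"
        using Comp_Hom[OF v(1) k(1)] .
      have "s1 \<cdot> (k \<cdot> v) = a"
        using Comp_assoc[OF v(1) k(1) P(3)] k(2) v(2) by simp
      moreover have "prj2 \<psi> \<cdot> (s2 \<cdot> (k \<cdot> v)) = c"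
        using Comp_assoc[OF v(1) k(1) P(4)] Comp_assoc[OF v(1) Comp_Hom[OF k(1) P(4)] E(6)] k(3) v(3)
        by simp
      ultimately show ?thesis
        using poly_act_nested[OF \<phi> \<psi> pb u kv] v(4) \<chi>(1) Comp_assoc[OF v(1) k(1) u(1)]
          Comp_assoc[OF v(1) uk D(3)] by simp
    qed
    with mem \<chi>(2) show ?thesis by blast
  qed
  show ?L if R: ?R
  proof -
    from R have \<chi>: "\<chi> \<in> poly_datas C p r" and b: "base \<chi> = base \<psi> \<cdot> base \<phi>" by auto
    note F = poly_datasD[OF \<chi>]
    obtain s1 s2 u where pb: "is_pullback C (base \<phi>) (prj1 \<psi>) s1 s2"
      and u: "u \<in> Hom C (Dom C s1) (Dom C (prj1 \<phi>))" "prj1 \<phi> \<cdot> u = s1" "prj2 \<phi> \<cdot> u = sharp \<psi> \<cdot> s2"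
      using composite_square[OF hp \<phi> \<psi> q] by blast
    note P = pullbackD[OF pb]
    \<comment> \<open>By pasting, both squares are pullbacks of \<open>r\<close> along
      \<open>base \<psi> \<cdot> base \<phi>\<close>; \<open>k\<close> is the comparison between
      them.\<close>
    obtain k where k: "k \<in> Hom C (Dom C (prj1 \<chi>)) (Dom C s1)" "is_iso C k" "s1 \<cdot> k = prj1 \<chi>"
      "(prj2 \<psi> \<cdot> s2) \<cdot> k = prj2 \<chi>"
      using pullback_unique[OF F(2)[unfolded b] pullback_paste[OF pb E(2)]] by blast
    have k2: "prj2 \<psi> \<cdot> (s2 \<cdot> k) = prj2 \<chi>"
      using Comp_assoc[OF k(1) P(4) E(6)] k(4) by simp
    \<comment> \<open>The hypothesis on actions is evaluated at the universal element of
      \<open>\<chi>\<close>, which \<open>k\<close> represents in the iterated pullback.\<close>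
    have "sharp \<chi> = poly_act C \<phi> (prj1 \<chi>) (poly_act C \<psi> (base \<phi> \<cdot> prj1 \<chi>) (prj2 \<chi>))"
      using R pullback_cone[OF F(2)] poly_act_projections[OF \<chi>] by metis
    also have "\<dots> = sharp \<phi> \<cdot> (u \<cdot> k)"
      using poly_act_nested[OF \<phi> \<psi> pb u k(1,3) k2] .
    finally show ?thesis
      using b F(2) pb u k k2 unfolding poly_composite_def by blast
  qed
qed

lemma poly_id_datas: "p \<in> Arr C \<Longrightarrow> poly_id C p \<in> poly_datas C p p"
  using pullback_Id[of p] Id_Hom Dom_Obj Cod_Obj Comp_Id[OF Hom_Arr]
  by (simp add: poly_datas_def poly_id_def)

text \<open>Cones for the identity have first leg \<open>p \<cdot> b\<close>, and \<open>b\<close>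
  is then its own lift.\<close>

lemma poly_act_poly_id:
  assumes p: "p \<in> Arr C" and b: "b \<in> Hom C w (Dom C p)"
  shows "poly_act C (poly_id C p) (p \<cdot> b) b = b"
  using poly_act_eq[OF poly_id_datas[OF p], of b w] b Id_Comp[OF b] by (simp add: poly_id_def)

end

section \<open>Equivalence classes of representatives and their composition\<close>

locale pullback_category = category +
  assumes pullbacks: "has_pullbacks C"
begin

definition poly_class :: "'b \<Rightarrow> 'b \<Rightarrow> 'b poly_data \<Rightarrow> 'b poly_data set" where
  "poly_class p q \<phi> = poly_equiv C p q `` {\<phi>}"

lemma poly_class_iff:
  assumes \<phi>: "\<phi> \<in> poly_datas C p q"
  shows "\<phi>' \<in> poly_class p q \<phi> \<longleftrightarrow> \<phi>' \<in> poly_datas C p q \<and> base \<phi> = base \<phi>' \<and>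
    (\<forall>w a b. cone C (base \<phi>) q w a b \<longrightarrow> poly_act C \<phi> a b = poly_act C \<phi>' a b)"
  using poly_equiv_iff[OF \<phi>] by (auto simp: poly_class_def poly_equiv_def)

text \<open>Ensures that the inner action in the composite formula is evaluated at a genuine
  cone.\<close>

lemma cone_base:
  assumes \<phi>: "\<phi> \<in> poly_datas C p q" and \<psi>: "\<psi> \<in> poly_datas C q r"
    and c: "cone C (base \<psi> \<cdot> base \<phi>) r w a c"
  shows "cone C (base \<psi>) r w (base \<phi> \<cdot> a) c"
proof -
  note D = poly_datasD[OF \<phi>] and E = poly_datasD[OF \<psi>]
  have a: "a \<in> Hom C w (Cod C p)"
    using c HomD(2)[OF Comp_Hom[OF D(1) E(1)]] by (simp add: cone_def)
  then show ?thesis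
    using c Comp_Hom[OF a D(1)] Comp_assoc[OF a D(1) E(1)] E(7) by (simp add: cone_def)
qed

text \<open>The corresponding guarantee for the outer action: the inner result lies over
  \<open>base \<phi> \<cdot> a\<close>.\<close>

lemma cone_poly_act:
  assumes \<phi>: "\<phi> \<in> poly_datas C p q" and \<psi>: "\<psi> \<in> poly_datas C q r" and q: "q \<in> Arr C"
    and c: "cone C (base \<psi> \<cdot> base \<phi>) r w a c"
  shows "cone C (base \<phi>) q w a (poly_act C \<psi> (base \<phi> \<cdot> a) c)"
proof -
  note D = poly_datasD[OF \<phi>] and E = poly_datasD[OF \<psi>]
  have "w \<in> Obj C" "a \<in> Hom C w (Dom C (base \<phi>))"
    using c HomD(2)[OF Comp_Hom[OF D(1) E(1)]] D(7) by (simp_all add: cone_def)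
  then show ?thesis
    using poly_act_Hom[OF \<psi> q cone_base[OF \<phi> \<psi> c]] by (simp add: cone_def)
qed

text \<open>Well-definedness of composition. Equivalent factors have equal bases and actions, hence
  so do their composites. Conversely, being a composite depends only on base and action, so it
  passes from \<open>\<chi>\<close> to everything equivalent to it.\<close>

lemma poly_class_composite:
  assumes \<phi>: "\<phi> \<in> poly_datas C p q" and \<psi>: "\<psi> \<in> poly_datas C q r"
    and p: "p \<in> Arr C" and q: "q \<in> Arr C" and \<chi>: "poly_composite C r \<phi> \<psi> \<chi>"
  shows "{\<chi>'. \<exists>\<phi>' \<in> poly_class p q \<phi>. \<exists>\<psi>' \<in> poly_class q r \<psi>. poly_composite C r \<phi>' \<psi>' \<chi>'} =
    poly_class p r \<chi>"
proof (intro set_eqI iffI)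
  note comp = poly_composite_iff[OF pullbacks _ _ p q]
  have X: "\<chi> \<in> poly_datas C p r" "base \<chi> = base \<psi> \<cdot> base \<phi>"
    "\<And>w a c. cone C (base \<chi>) r w a c \<Longrightarrow>
       poly_act C \<chi> a c = poly_act C \<phi> a (poly_act C \<psi> (base \<phi> \<cdot> a) c)"
    using \<chi> comp[OF \<phi> \<psi>] by auto
  fix \<chi>'
  show "\<chi>' \<in> poly_class p r \<chi>"
    if "\<chi>' \<in> {\<chi>'. \<exists>\<phi>' \<in> poly_class p q \<phi>. \<exists>\<psi>' \<in> poly_class q r \<psi>. poly_composite C r \<phi>' \<psi>' \<chi>'}"
  proof -
    from that obtain \<phi>' \<psi>' where \<phi>': "\<phi>' \<in> poly_class p q \<phi>" and \<psi>': "\<psi>' \<in> poly_class q r \<psi>"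
      and c: "poly_composite C r \<phi>' \<psi>' \<chi>'" by blast
    have F: "\<phi>' \<in> poly_datas C p q" "base \<phi> = base \<phi>'"
      "\<And>w a b. cone C (base \<phi>) q w a b \<Longrightarrow> poly_act C \<phi> a b = poly_act C \<phi>' a b"
      using \<phi>' poly_class_iff[OF \<phi>] by auto
    have G: "\<psi>' \<in> poly_datas C q r" "base \<psi> = base \<psi>'"
      "\<And>w a b. cone C (base \<psi>) r w a b \<Longrightarrow> poly_act C \<psi> a b = poly_act C \<psi>' a b"
      using \<psi>' poly_class_iff[OF \<psi>] by auto
    have H: "\<chi>' \<in> poly_datas C p r" "base \<chi>' = base \<psi>' \<cdot> base \<phi>'"
      "\<And>w a c. cone C (base \<chi>') r w a c \<Longrightarrow>
         poly_act C \<chi>' a c = poly_act C \<phi>' a (poly_act C \<psi>' (base \<phi>' \<cdot> a) c)"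
      using c comp[OF F(1) G(1)] by auto
    have "poly_act C \<chi> a b = poly_act C \<chi>' a b" if c: "cone C (base \<chi>) r w a b" for w a b
    proof -
      have c': "cone C (base \<psi> \<cdot> base \<phi>) r w a b"
        using c X(2) by simp
      have "poly_act C \<chi> a b = poly_act C \<phi> a (poly_act C \<psi> (base \<phi> \<cdot> a) b)"
        using X(3)[OF c] .
      also have "\<dots> = poly_act C \<phi>' a (poly_act C \<psi> (base \<phi> \<cdot> a) b)"
        using F(3)[OF cone_poly_act[OF \<phi> \<psi> q c']] .
      also have "\<dots> = poly_act C \<phi>' a (poly_act C \<psi>' (base \<phi>' \<cdot> a) b)"
        using G(3)[OF cone_base[OF \<phi> \<psi> c']] F(2) by simp
      also have "\<dots> = poly_act C \<chi>' a b"
        using H(3)[of w a b] H(2) c' F(2) G(2) by simp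
      finally show ?thesis .
    qed
    then show ?thesis
      using poly_class_iff[OF X(1)] X(2) H(1,2) F(2) G(2) by simp
  qed
  show "\<chi>' \<in> {\<chi>'. \<exists>\<phi>' \<in> poly_class p q \<phi>. \<exists>\<psi>' \<in> poly_class q r \<psi>. poly_composite C r \<phi>' \<psi>' \<chi>'}"
    if "\<chi>' \<in> poly_class p r \<chi>"
  proof -
    \<comment> \<open>The original \<open>\<phi>\<close> and \<open>\<psi>\<close> already serve as
      the factors of \<open>\<chi>'\<close>.\<close>
    have "poly_composite C r \<phi> \<psi> \<chi>'"
      using that poly_class_iff[OF X(1)] comp[OF \<phi> \<psi>] X(2,3) by simp
    moreover have "\<phi> \<in> poly_class p q \<phi>" "\<psi> \<in> poly_class q r \<psi>"
      using \<phi> \<psi> by (simp_all add: poly_class_iff)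
    ultimately show ?thesis by blast
  qed
qed

section \<open>Unit and associativity laws for representatives\<close>

text \<open>The result of \<open>\<phi>\<close> at \<open>a\<close>, \<open>c\<close> lies over
  \<open>a\<close>, so the outer identity action returns it unchanged.\<close>

lemma poly_composite_id_right:
  assumes \<phi>: "\<phi> \<in> poly_datas C p q" and p: "p \<in> Arr C"
  shows "poly_composite C q (poly_id C p) \<phi> \<phi>"
proof -
  note D = poly_datasD[OF \<phi>]
  have "poly_act C \<phi> a c = poly_act C (poly_id C p) a (poly_act C \<phi> (base (poly_id C p) \<cdot> a) c)"
    if c: "cone C (base \<phi>) q w a c" for w a c
  proof -
    have "base (poly_id C p) \<cdot> a = a"
      using c D(7) Id_Comp[of a w "Cod C p"] by (simp add: cone_def poly_id_def)
    then show ?thesis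
      using poly_act_poly_id[OF p poly_act_Hom(1)[OF \<phi> p c]] poly_act_Hom(2)[OF \<phi> p c] by simp
  qed
  then show ?thesis
    using \<phi> Comp_Id[OF D(1)] poly_composite_iff[OF pullbacks poly_id_datas[OF p] \<phi> p p]
    by (simp add: poly_id_def)
qed

text \<open>The cone condition \<open>base \<phi> \<cdot> a = q \<cdot> c\<close> makes the inner
  identity action return \<open>c\<close>.\<close>

lemma poly_composite_id_left:
  assumes \<phi>: "\<phi> \<in> poly_datas C p q" and p: "p \<in> Arr C" and q: "q \<in> Arr C"
  shows "poly_composite C q \<phi> (poly_id C q) \<phi>"
proof -
  note D = poly_datasD[OF \<phi>]
  have "poly_act C \<phi> a c = poly_act C \<phi> a (poly_act C (poly_id C q) (base \<phi> \<cdot> a) c)"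
    if c: "cone C (base \<phi>) q w a c" for w a c
    using c poly_act_poly_id[OF q, of c w] by (simp add: cone_def)
  then show ?thesis
    using \<phi> Id_Comp[OF D(1)] poly_composite_iff[OF pullbacks \<phi> poly_id_datas[OF q] p q]
    by (simp add: poly_id_def)
qed

text \<open>Both bracketings act by applying \<open>\<theta>\<close>, then \<open>\<psi>\<close>,
  then \<open>\<phi>\<close>, each at the corresponding image of \<open>a\<close>. A single
  \<open>\<chi>\<close> is shown to represent both, which yields equality of the two
  classes.\<close>

lemma poly_composite_assoc:
  assumes \<phi>: "\<phi> \<in> poly_datas C o' p" and \<psi>: "\<psi> \<in> poly_datas C p q" and \<theta>: "\<theta> \<in> poly_datas C q r"
    and o': "o' \<in> Arr C" and p: "p \<in> Arr C" and q: "q \<in> Arr C"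
    and \<psi>\<phi>: "poly_composite C q \<phi> \<psi> \<psi>\<phi>" and \<theta>\<psi>: "poly_composite C r \<psi> \<theta> \<theta>\<psi>"
    and \<chi>: "poly_composite C r \<psi>\<phi> \<theta> \<chi>"
  shows "poly_composite C r \<phi> \<theta>\<psi> \<chi>"
proof -
  note D = poly_datasD[OF \<phi>] and E = poly_datasD[OF \<psi>] and F = poly_datasD[OF \<theta>]
  note A = \<psi>\<phi>[unfolded poly_composite_iff[OF pullbacks \<phi> \<psi> o' p]]
  note B = \<theta>\<psi>[unfolded poly_composite_iff[OF pullbacks \<psi> \<theta> p q]]
  note X = \<chi>[unfolded poly_composite_iff[OF pullbacks conjunct1[OF A] \<theta> o' q]]
  have base: "base \<chi> = base \<theta>\<psi> \<cdot> base \<phi>"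
    using A B X Comp_assoc[OF D(1) E(1) F(1)] by simp
  have "poly_act C \<chi> a d = poly_act C \<phi> a (poly_act C \<theta>\<psi> (base \<phi> \<cdot> a) d)"
    if c: "cone C (base \<chi>) r w a d" for w a d
  proof -
    have a: "a \<in> Hom C w (Cod C o')"
      using c poly_datasD(7)[OF conjunct1[OF X]] by (simp add: cone_def)
    let ?d = "poly_act C \<theta> (base \<psi> \<cdot> (base \<phi> \<cdot> a)) d"
    have bb: "base \<psi>\<phi> \<cdot> a = base \<psi> \<cdot> (base \<phi> \<cdot> a)"
      using A Comp_assoc[OF a D(1) E(1)] by simp
    \<comment> \<open>The action of \<open>\<psi>\<phi>\<close> may be unfolded only at a cone; here
      its second leg is the result of \<open>\<theta>\<close>.\<close>
    have "cone C (base \<psi>\<phi>) q w a ?d"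
      using cone_poly_act[OF conjunct1[OF A] \<theta> q, of w a d] c X bb by simp
    then have "poly_act C \<chi> a d = poly_act C \<phi> a (poly_act C \<psi> (base \<phi> \<cdot> a) ?d)"
      using X A c bb by metis
    \<comment> \<open>The two inner actions are folded into that of \<open>\<theta>\<psi>\<close>,
      at the cone with legs \<open>base \<phi> \<cdot> a\<close> and \<open>d\<close>.\<close>
    also have "\<dots> = poly_act C \<phi> a (poly_act C \<theta>\<psi> (base \<phi> \<cdot> a) d)"
      using B cone_base[OF \<phi> conjunct1[OF B], of w a d] c base by metis
    finally show ?thesis .
  qed
  then show ?thesis
    using X base poly_composite_iff[OF pullbacks \<phi> conjunct1[OF B] o' p] by simp
qed

section \<open>Category laws for arrows of \<open>Poly\<close>\<close>

lemma Poly_HomE: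
  assumes "f \<in> Hom (Poly C) p q"
  obtains \<phi> where "f = (p, poly_class p q \<phi>, q)" "\<phi> \<in> poly_datas C p q"
    "exponentiable C p" "exponentiable C q" "p \<in> Arr C" "q \<in> Arr C"
  using assms that
  by (auto simp: Hom_def Poly_def quotient_def exponentiable_def poly_class_def)

lemma Poly_HomI:
  assumes "\<phi> \<in> poly_datas C p q" "exponentiable C p" "exponentiable C q"
  shows "(p, poly_class p q \<phi>, q) \<in> Hom (Poly C) p q"
  using assms by (auto simp: Hom_def Poly_def poly_class_def intro: quotientI)

lemma Poly_Comp:
  assumes "\<phi> \<in> poly_datas C p q" "\<psi> \<in> poly_datas C q r" "p \<in> Arr C" "q \<in> Arr C"
    "poly_composite C r \<phi> \<psi> \<chi>"
  shows "(q, poly_class q r \<psi>, r) \<cdot>\<^bsub>Poly C\<^esub> (p, poly_class p q \<phi>, q) = (p, poly_class p r \<chi>, r)"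
  using poly_class_composite[OF assms] by (simp add: Poly_def)

lemma poly_compositeE:
  assumes \<phi>: "\<phi> \<in> poly_datas C p q" and \<psi>: "\<psi> \<in> poly_datas C q r"
    and p: "p \<in> Arr C" and q: "q \<in> Arr C"
  obtains \<chi> where "poly_composite C r \<phi> \<psi> \<chi>" "\<chi> \<in> poly_datas C p r"
  using poly_composite_exists[OF pullbacks \<phi> \<psi> q] poly_composite_iff[OF pullbacks \<phi> \<psi> p q] by metis

lemma Poly_Id: "Id (Poly C) p = (p, poly_class p p (poly_id C p), p)"
  by (simp add: Poly_def poly_class_def)

lemma category_Poly: "category (Poly C)"
proof
  show "Dom (Poly C) f \<in> Obj (Poly C)" "Cod (Poly C) f \<in> Obj (Poly C)" if "f \<in> Arr (Poly C)" for f
    using that by (auto simp: Poly_def)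
  show "Id (Poly C) p \<in> Hom (Poly C) p p" if "p \<in> Obj (Poly C)" for p
  proof -
    have "exponentiable C p"
      using that by (simp add: Poly_def)
    then show ?thesis
      unfolding Poly_Id using Poly_HomI poly_id_datas by (simp add: exponentiable_def)
  qed
next
  fix f g p q r
  assume "f \<in> Hom (Poly C) p q" "g \<in> Hom (Poly C) q r"
  \<comment> \<open>A composite of representatives exists, and its class is the whole composite of
    the classes.\<close>
  then show "g \<cdot>\<^bsub>Poly C\<^esub> f \<in> Hom (Poly C) p r"
    by (elim Poly_HomE) (metis Poly_Comp Poly_HomI poly_compositeE)
next
  fix f p q
  assume "f \<in> Hom (Poly C) p q"
  then obtain \<phi> where f: "f = (p, poly_class p q \<phi>, q)" "\<phi> \<in> poly_datas C p q"
    and pq: "p \<in> Arr C" "q \<in> Arr C"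
    by (rule Poly_HomE)
  show "f \<cdot>\<^bsub>Poly C\<^esub> Id (Poly C) p = f"
    unfolding f(1) Poly_Id
    using f(2) pq by (intro Poly_Comp poly_id_datas poly_composite_id_right)
  show "Id (Poly C) q \<cdot>\<^bsub>Poly C\<^esub> f = f"
    unfolding f(1) Poly_Id
    using f(2) pq by (intro Poly_Comp poly_id_datas poly_composite_id_left)
next
  fix f g h p q r s
  assume "f \<in> Hom (Poly C) p q" "g \<in> Hom (Poly C) q r" "h \<in> Hom (Poly C) r s"
  then obtain \<phi> \<psi> \<theta> where
    f: "f = (p, poly_class p q \<phi>, q)" "\<phi> \<in> poly_datas C p q" and
    g: "g = (q, poly_class q r \<psi>, r)" "\<psi> \<in> poly_datas C q r" and
    h: "h = (r, poly_class r s \<theta>, s)" "\<theta> \<in> poly_datas C r s" and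
    arr: "p \<in> Arr C" "q \<in> Arr C" "r \<in> Arr C"
    by (elim Poly_HomE) blast
  obtain \<psi>\<phi> where 1: "poly_composite C r \<phi> \<psi> \<psi>\<phi>" "\<psi>\<phi> \<in> poly_datas C p r"
    using poly_compositeE f g arr by metis
  obtain \<theta>\<psi> where 2: "poly_composite C s \<psi> \<theta> \<theta>\<psi>" "\<theta>\<psi> \<in> poly_datas C q s"
    using poly_compositeE g h arr by metis
  obtain \<chi> where 3: "poly_composite C s \<psi>\<phi> \<theta> \<chi>"
    using poly_compositeE[OF 1(2) h(2) arr(1,3)] by blast
  \<comment> \<open>\<open>\<chi>\<close> was chosen for the bracketing that composes
    \<open>\<phi>\<close> and \<open>\<psi>\<close> first; it also represents the other one.\<close>
  have "poly_composite C s \<phi> \<theta>\<psi> \<chi>"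
    using poly_composite_assoc[OF f(2) g(2) h(2) arr 1(1) 2(1) 3] .
  then show "h \<cdot>\<^bsub>Poly C\<^esub> (g \<cdot>\<^bsub>Poly C\<^esub> f) = (h \<cdot>\<^bsub>Poly C\<^esub> g) \<cdot>\<^bsub>Poly C\<^esub> f"
    unfolding f(1) g(1) h(1)
    using Poly_Comp[OF f(2) g(2) arr(1,2) 1(1)] Poly_Comp[OF g(2) h(2) arr(2,3) 2(1)]
      Poly_Comp[OF 1(2) h(2) arr(1,3) 3] Poly_Comp[OF f(2) 2(2) arr(1,2)] by simp
qed

end

theorem theorem3p15:
  fixes E :: "('o, 'm) cat"
  assumes "category E" and "has_pullbacks E"
  shows "category (Poly E)"
proof -
  interpret pullback_category E
    using assms by (simp add: pullback_category_def pullback_category_axioms_def)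
  show ?thesis
    by (rule category_Poly)
qed

end
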